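(* Let $H\overset{\partial_2}{\rightarrow}N\overset{\partial_1}{\rightarrow}Q$ be a $2$-crossed module with Peiffer lifting $\{-,-\}:N\times N\to H$, and let $\phi:P\to Q$ be a morphism of groups. Let $\phi^*(N)=\{(n,p)\in N\times P\mid \partial_1(n)=\phi(p)\}$, a subgroup of $N\times P$. Define $$\partial_2^*:\partial_2^{-1}(\mathrm{Ker}\,\partial_1)\to\phi^*(N),\quad \partial_2^*(h)=(\partial_2(h),1),\qquad \partial_1^*:\phi^*(N)\to P,\quad \partial_1^*(n,p)=p,$$ let $P$ act on $\phi^*(N)$ by ${}^{p}(n,p')=({}^{\phi(p)}n,\;pp'p^{-1})$ and on $\partial_2^{-1}(\mathrm{Ker}\,\partial_1)$ by ${}^{p}h={}^{\phi(p)}h$, and let the Peiffer lifting $\phi^*(N)\times\phi^*(N)\to\partial_2^{-1}(\mathrm{Ker}\,\partial_1)$ be $\{(n,p),(n',p')\}=\{n,n'\}$. Then $$\partial_2^{-1}(\mathrm{Ker}\,\partial_1)\overset{\partial_2^*}{\rightarrow}\phi^*(N)\overset{\partial_1^*}{\rightarrow}P$$ is a pullback $2$-crossed module of $\{H,N,Q,\partial_2,\partial_1\}$ along $\phi$, with structure morphism $(\phi'',\phi',\phi)$ to $\{H,N,Q,\partial_2,\partial_1\}$ given by $\phi''(h)=h$ and $\phi'(n,p)=n$.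
   Context: All actions are left actions by group automorphisms; $P$ acts on itself by conjugation. A $2$-crossed module $\{L,M,P,\partial_2,\partial_1\}$ is a normal complex of groups $L\overset{\partial_2}{\rightarrow}M\overset{\partial_1}{\rightarrow}P$ (that is, $\partial_2(L)\unlhd M$, $\partial_1(M)\unlhd P$, $\partial_1\partial_2=1$) together with an action of $P$ on all three groups, the action of $P$ on itself being conjugation, such that $\partial_2,\partial_1$ are $P$-equivariant, and a map $\{-,-\}:M\times M\to L$ (the Peiffer lifting) such that for all $m,m_0,m_1,m_2\in M$, $l,l_0,l_1\in L$, $p\in P$: PL1: $\partial_2\{m_0,m_1\}=m_0m_1m_0^{-1}\,({}^{\partial_1 m_0}m_1^{-1})$; PL2: $\{\partial_2l_0,\partial_2l_1\}=[l_0,l_1]=l_0l_1l_0^{-1}l_1^{-1}$; PL3: $\{m_0,m_1m_2\}={}^{m_0m_1m_0^{-1}}\{m_0,m_2\}\,\{m_0,m_1\}$ and $\{m_0m_1,m_2\}=\{m_0,m_1m_2m_1^{-1}\}\,({}^{\partial_1m_0}\{m_1,m_2\})$; PL4: (a) $\{\partial_2l,m\}=l\,({}^{m}l^{-1})$ and (b) $\{m,\partial_2l\}={}^{m}l\,({}^{\partial_1m}l^{-1})$; PL5: ${}^{p}\{m_0,m_1\}=\{{}^{p}m_0,{}^{p}m_1\}$. Here $M$ acts on $L$ by ${}^{m}l=l\{\partial_2l^{-1},m\}$. A morphism of $2$-crossed modules $(f_2,f_1,f_0):\{L,M,P,\partial_2,\partial_1\}\to\{L',M',P',\partial_2',\partial_1'\}$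 consists of group homomorphisms $f_2:L\to L'$, $f_1:M\to M'$, $f_0:P\to P'$ with $f_0\partial_1=\partial_1'f_1$, $f_1\partial_2=\partial_2'f_2$, $f_1({}^{p}m)={}^{f_0(p)}f_1(m)$, $f_2({}^{p}l)={}^{f_0(p)}f_2(l)$ and $\{f_1(m),f_1(m')\}=f_2\{m,m'\}$. Given a $2$-crossed module $\{H,N,Q,\partial_2,\partial_1\}$ and a group morphism $\phi:P\to Q$, a pullback $2$-crossed module along $\phi$ is a $2$-crossed module $\{H^*,N^*,P,\partial_2^*,\partial_1^*\}$ together with a morphism of $2$-crossed modules $(\phi'',\phi',\phi):\{H^*,N^*,P,\partial_2^*,\partial_1^*\}\to\{H,N,Q,\partial_2,\partial_1\}$ such that for any morphism of $2$-crossed modules $(f_2,f_1,\phi):\{B_2,B_1,P,\partial_2',\partial_1'\}\to\{H,N,Q,\partial_2,\partial_1\}$ there is a unique morphism of $2$-crossed modules $(f_2^*,f_1^*,\mathrm{id}_P):\{B_2,B_1,P,\partial_2',\partial_1'\}\to\{H^*,N^*,P,\partial_2^*,\partial_1^*\}$ with $\phi''f_2^*=f_2$ and $\phi'f_1^*=f_1$. *)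

theory Defs
  imports "HOL-Algebra.Bij" "HOL-Algebra.Coset"
begin

section \<open>2-crossed modules\<close>

record ('l, 'm, 'p) two_xmod_data =
  grpL :: "'l monoid"
  grpM :: "'m monoid"
  grpP :: "'p monoid"
  bd2 :: "'l \<Rightarrow> 'm"
  bd1 :: "'m \<Rightarrow> 'p"
  actL :: "'p \<Rightarrow> 'l \<Rightarrow> 'l"
  actM :: "'p \<Rightarrow> 'm \<Rightarrow> 'm"
  peiffer :: "'m \<Rightarrow> 'm \<Rightarrow> 'l"

locale two_xmod_data =
  fixes X :: "('l, 'm, 'p) two_xmod_data"
begin

abbreviation L :: "'l monoid" where "L \<equiv> grpL X"
abbreviation M :: "'m monoid" where "M \<equiv> grpM X"
abbreviation P :: "'p monoid" where "P \<equiv> grpP X"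

abbreviation multL (infixl "\<cdot>\<^sub>L" 70) where "x \<cdot>\<^sub>L y \<equiv> x \<otimes>\<^bsub>L\<^esub> y"
abbreviation multM (infixl "\<cdot>\<^sub>M" 70) where "x \<cdot>\<^sub>M y \<equiv> x \<otimes>\<^bsub>M\<^esub> y"
abbreviation multP (infixl "\<cdot>\<^sub>P" 70) where "x \<cdot>\<^sub>P y \<equiv> x \<otimes>\<^bsub>P\<^esub> y"

abbreviation bdL ("\<partial>\<^sub>2") where "\<partial>\<^sub>2 \<equiv> bd2 X"
abbreviation bdM ("\<partial>\<^sub>1") where "\<partial>\<^sub>1 \<equiv> bd1 X"
abbreviation lifting ("\<lbrace>_, _\<rbrace>") where "\<lbrace>m, m'\<rbrace> \<equiv> peiffer X m m'"

text \<open>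
  The induced action of \<open>M\<close> on \<open>L\<close>. That it is an action by automorphisms follows from
  the axioms below; see \<open>actML_action\<close>.
\<close>

definition actML :: "'m \<Rightarrow> 'l \<Rightarrow> 'l" where
  "actML m l = l \<cdot>\<^sub>L \<lbrace>\<partial>\<^sub>2 (inv\<^bsub>L\<^esub> l), m\<rbrace>"

end

text \<open>
  A left action of \<open>P\<close> on \<open>G\<close> by group automorphisms is a homomorphism from \<open>P\<close> to the
  library's \<open>AutoGroup G\<close>. The elements of \<open>AutoGroup G\<close> are extensional functions, so a
  concrete action has to be restricted to \<open>carrier G\<close>.
\<close>

locale two_crossed_module = two_xmod_data X
  for X :: "('l, 'm, 'p) two_xmod_data" +
  assumes group_L: "group L" and group_M: "group M" and group_P: "group P"
    and bd2_hom: "\<partial>\<^sub>2 \<in> hom L M"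
    and bd1_hom: "\<partial>\<^sub>1 \<in> hom M P"
    and bd2_normal: "\<partial>\<^sub>2 ` carrier L \<lhd> M"
    and bd1_normal: "\<partial>\<^sub>1 ` carrier M \<lhd> P"
    and bd1_bd2: "l \<in> carrier L \<Longrightarrow> \<partial>\<^sub>1 (\<partial>\<^sub>2 l) = \<one>\<^bsub>P\<^esub>"
    and actL_action: "actL X \<in> hom P (AutoGroup L)"
    and actM_action: "actM X \<in> hom P (AutoGroup M)"
    and bd2_equivariant:
      "\<lbrakk>p \<in> carrier P; l \<in> carrier L\<rbrakk> \<Longrightarrow> \<partial>\<^sub>2 (actL X p l) = actM X p (\<partial>\<^sub>2 l)"
    and bd1_equivariant:
      "\<lbrakk>p \<in> carrier P; m \<in> carrier M\<rbrakk> \<Longrightarrow> \<partial>\<^sub>1 (actM X p m) = p \<cdot>\<^sub>P \<partial>\<^sub>1 m \<cdot>\<^sub>P inv\<^bsub>P\<^esub> p"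
    and peiffer_closed:
      "\<lbrakk>m \<in> carrier M; m' \<in> carrier M\<rbrakk> \<Longrightarrow> \<lbrace>m, m'\<rbrace> \<in> carrier L"
    and PL1: "\<lbrakk>m\<^sub>0 \<in> carrier M; m\<^sub>1 \<in> carrier M\<rbrakk> \<Longrightarrow>
      \<partial>\<^sub>2 \<lbrace>m\<^sub>0, m\<^sub>1\<rbrace> = m\<^sub>0 \<cdot>\<^sub>M m\<^sub>1 \<cdot>\<^sub>M inv\<^bsub>M\<^esub> m\<^sub>0 \<cdot>\<^sub>M actM X (\<partial>\<^sub>1 m\<^sub>0) (inv\<^bsub>M\<^esub> m\<^sub>1)"
    and PL2: "\<lbrakk>l\<^sub>0 \<in> carrier L; l\<^sub>1 \<in> carrier L\<rbrakk> \<Longrightarrow>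
      \<lbrace>\<partial>\<^sub>2 l\<^sub>0, \<partial>\<^sub>2 l\<^sub>1\<rbrace> = l\<^sub>0 \<cdot>\<^sub>L l\<^sub>1 \<cdot>\<^sub>L inv\<^bsub>L\<^esub> l\<^sub>0 \<cdot>\<^sub>L inv\<^bsub>L\<^esub> l\<^sub>1"
    and PL3_right: "\<lbrakk>m\<^sub>0 \<in> carrier M; m\<^sub>1 \<in> carrier M; m\<^sub>2 \<in> carrier M\<rbrakk> \<Longrightarrow>
      \<lbrace>m\<^sub>0, m\<^sub>1 \<cdot>\<^sub>M m\<^sub>2\<rbrace> = actML (m\<^sub>0 \<cdot>\<^sub>M m\<^sub>1 \<cdot>\<^sub>M inv\<^bsub>M\<^esub> m\<^sub>0) \<lbrace>m\<^sub>0, m\<^sub>2\<rbrace> \<cdot>\<^sub>L \<lbrace>m\<^sub>0, m\<^sub>1\<rbrace>"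
    and PL3_left: "\<lbrakk>m\<^sub>0 \<in> carrier M; m\<^sub>1 \<in> carrier M; m\<^sub>2 \<in> carrier M\<rbrakk> \<Longrightarrow>
      \<lbrace>m\<^sub>0 \<cdot>\<^sub>M m\<^sub>1, m\<^sub>2\<rbrace> = \<lbrace>m\<^sub>0, m\<^sub>1 \<cdot>\<^sub>M m\<^sub>2 \<cdot>\<^sub>M inv\<^bsub>M\<^esub> m\<^sub>1\<rbrace> \<cdot>\<^sub>L actL X (\<partial>\<^sub>1 m\<^sub>0) \<lbrace>m\<^sub>1, m\<^sub>2\<rbrace>"
    and PL4a: "\<lbrakk>l \<in> carrier L; m \<in> carrier M\<rbrakk> \<Longrightarrow>
      \<lbrace>\<partial>\<^sub>2 l, m\<rbrace> = l \<cdot>\<^sub>L actML m (inv\<^bsub>L\<^esub> l)"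
    and PL4b: "\<lbrakk>m \<in> carrier M; l \<in> carrier L\<rbrakk> \<Longrightarrow>
      \<lbrace>m, \<partial>\<^sub>2 l\<rbrace> = actML m l \<cdot>\<^sub>L actL X (\<partial>\<^sub>1 m) (inv\<^bsub>L\<^esub> l)"
    and PL5: "\<lbrakk>p \<in> carrier P; m\<^sub>0 \<in> carrier M; m\<^sub>1 \<in> carrier M\<rbrakk> \<Longrightarrow>
      actL X p \<lbrace>m\<^sub>0, m\<^sub>1\<rbrace> = \<lbrace>actM X p m\<^sub>0, actM X p m\<^sub>1\<rbrace>"
begin

lemma bd1_closed: "m \<in> carrier M \<Longrightarrow> \<partial>\<^sub>1 m \<in> carrier P"
  using bd1_hom by (auto simp: hom_def)

lemma bd2_closed: "l \<in> carrier L \<Longrightarrow> \<partial>\<^sub>2 l \<in> carrier M"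
  using bd2_hom by (auto simp: hom_def)

lemma bd2_mult: "\<lbrakk>l \<in> carrier L; l' \<in> carrier L\<rbrakk> \<Longrightarrow> \<partial>\<^sub>2 (l \<cdot>\<^sub>L l') = \<partial>\<^sub>2 l \<cdot>\<^sub>M \<partial>\<^sub>2 l'"
  using bd2_hom by (auto simp: hom_def)

lemma bd2_inv: "l \<in> carrier L \<Longrightarrow> \<partial>\<^sub>2 (inv\<^bsub>L\<^esub> l) = inv\<^bsub>M\<^esub> \<partial>\<^sub>2 l"
  by (rule group_hom.hom_inv)
    (auto simp: group_hom_def group_hom_axioms_def group_L group_M bd2_hom)

lemma actL_auto: "p \<in> carrier P \<Longrightarrow> actL X p \<in> auto L"
  using actL_action by (auto simp: hom_def AutoGroup_def)

lemma actL_closed: "\<lbrakk>p \<in> carrier P; l \<in> carrier L\<rbrakk> \<Longrightarrow> actL X p l \<in> carrier L"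
  using actL_auto by (auto simp: auto_def hom_def)

lemma actL_hom: "\<lbrakk>p \<in> carrier P; l \<in> carrier L; l' \<in> carrier L\<rbrakk>
    \<Longrightarrow> actL X p (l \<cdot>\<^sub>L l') = actL X p l \<cdot>\<^sub>L actL X p l'"
  using actL_auto by (auto simp: auto_def hom_def)

lemma actL_inv: "\<lbrakk>p \<in> carrier P; l \<in> carrier L\<rbrakk>
    \<Longrightarrow> actL X p (inv\<^bsub>L\<^esub> l) = inv\<^bsub>L\<^esub> actL X p l"
  by (rule group_hom.hom_inv)
    (use actL_auto in \<open>auto simp: group_hom_def group_hom_axioms_def group_L auto_def\<close>)

lemma actL_compose: "\<lbrakk>p \<in> carrier P; q \<in> carrier P; l \<in> carrier L\<rbrakk>
    \<Longrightarrow> actL X (p \<cdot>\<^sub>P q) l = actL X p (actL X q l)"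
proof -
  assume a: "p \<in> carrier P" "q \<in> carrier P" "l \<in> carrier L"
  have "actL X (p \<cdot>\<^sub>P q) = actL X p \<otimes>\<^bsub>AutoGroup L\<^esub> actL X q"
    using actL_action a by (auto simp: hom_def)
  moreover have "actL X p \<in> Bij (carrier L)" "actL X q \<in> Bij (carrier L)"
    using actL_auto a by (auto simp: auto_def)
  ultimately show ?thesis using a by (simp add: AutoGroup_def BijGroup_def compose_def)
qed

lemma actML_closed: "\<lbrakk>m \<in> carrier M; l \<in> carrier L\<rbrakk> \<Longrightarrow> actML m l \<in> carrier L"
  unfolding actML_def
  by (simp add: group_L group.inv_closed monoid.m_closed group.is_monoid bd2_closed peiffer_closed)

lemma actML_eq: "\<lbrakk>m \<in> carrier M; l \<in> carrier L\<rbrakk>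
    \<Longrightarrow> actML m l = \<lbrace>m, \<partial>\<^sub>2 l\<rbrace> \<cdot>\<^sub>L actL X (\<partial>\<^sub>1 m) l"
proof -
  assume a: "m \<in> carrier M" "l \<in> carrier L"
  interpret L: group L by (rule group_L)
  show ?thesis
    using a by (simp add: PL4b actL_inv bd1_closed actL_closed actML_closed L.m_assoc)
qed

lemma bd2_actML: "\<lbrakk>m \<in> carrier M; l \<in> carrier L\<rbrakk>
    \<Longrightarrow> \<partial>\<^sub>2 (actML m l) = m \<cdot>\<^sub>M \<partial>\<^sub>2 l \<cdot>\<^sub>M inv\<^bsub>M\<^esub> m"
proof -
  assume a: "m \<in> carrier M" "l \<in> carrier L"
  interpret M: group M by (rule group_M)
  have aut: "actM X (\<partial>\<^sub>1 m) \<in> auto M"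
    using actM_action a bd1_closed by (auto simp: hom_def AutoGroup_def)
  then interpret h: group_hom M M "actM X (\<partial>\<^sub>1 m)"
    by unfold_locales (auto simp: auto_def)
  have "\<partial>\<^sub>2 (actML m l) = m \<cdot>\<^sub>M \<partial>\<^sub>2 l \<cdot>\<^sub>M inv\<^bsub>M\<^esub> m \<cdot>\<^sub>M actM X (\<partial>\<^sub>1 m) (inv\<^bsub>M\<^esub> \<partial>\<^sub>2 l) \<cdot>\<^sub>M actM X (\<partial>\<^sub>1 m) (\<partial>\<^sub>2 l)"
    using a by (simp add: actML_eq bd2_mult peiffer_closed bd2_closed bd1_closed actL_closed
        PL1 bd2_equivariant)
  then show ?thesis using a by (simp add: bd2_closed M.m_assoc)
qed

lemma actML_bd2: "\<lbrakk>k \<in> carrier L; l \<in> carrier L\<rbrakk>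
    \<Longrightarrow> actML (\<partial>\<^sub>2 k) l = k \<cdot>\<^sub>L l \<cdot>\<^sub>L inv\<^bsub>L\<^esub> k"
proof -
  assume a: "k \<in> carrier L" "l \<in> carrier L"
  interpret L: group L by (rule group_L)
  show ?thesis using a by (simp add: actML_def PL2 L.m_assoc[symmetric])
qed

lemma actML_mult: "\<lbrakk>m \<in> carrier M; l \<in> carrier L; l' \<in> carrier L\<rbrakk>
    \<Longrightarrow> actML m (l \<cdot>\<^sub>L l') = actML m l \<cdot>\<^sub>L actML m l'"
proof -
  assume a: "m \<in> carrier M" "l \<in> carrier L" "l' \<in> carrier L"
  interpret L: group L by (rule group_L)
  let ?a = "actL X (\<partial>\<^sub>1 m)"
  note cl = a bd1_closed bd2_closed actL_closed actML_closed peiffer_closed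
  have "actML m (l \<cdot>\<^sub>L l') = actML (\<partial>\<^sub>2 (actML m l)) \<lbrace>m, \<partial>\<^sub>2 l'\<rbrace> \<cdot>\<^sub>L \<lbrace>m, \<partial>\<^sub>2 l\<rbrace> \<cdot>\<^sub>L (?a l \<cdot>\<^sub>L ?a l')"
    using cl by (simp add: actML_eq bd2_mult PL3_right actL_hom bd2_actML flip: bd2_actML)
  also have "\<dots> = actML (\<partial>\<^sub>2 (actML m l)) \<lbrace>m, \<partial>\<^sub>2 l'\<rbrace> \<cdot>\<^sub>L (\<lbrace>m, \<partial>\<^sub>2 l\<rbrace> \<cdot>\<^sub>L ?a l) \<cdot>\<^sub>L ?a l'"
    using cl by (simp add: L.m_assoc)
  also have "\<dots> = actML m l \<cdot>\<^sub>L \<lbrace>m, \<partial>\<^sub>2 l'\<rbrace> \<cdot>\<^sub>L inv\<^bsub>L\<^esub> actML m l \<cdot>\<^sub>L actML m l \<cdot>\<^sub>L ?a l'"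
    using cl by (simp add: actML_bd2 flip: actML_eq)
  also have "\<dots> = actML m l \<cdot>\<^sub>L actML m l'"
    using cl by (simp add: L.m_assoc actML_eq[of m l'])
  finally show ?thesis .
qed

lemma actML_compose: "\<lbrakk>m \<in> carrier M; m' \<in> carrier M; l \<in> carrier L\<rbrakk>
    \<Longrightarrow> actML (m \<cdot>\<^sub>M m') l = actML m (actML m' l)"
proof -
  assume a: "m \<in> carrier M" "m' \<in> carrier M" "l \<in> carrier L"
  interpret L: group L by (rule group_L)
  interpret M: group M by (rule group_M)
  note cl = a bd1_closed bd2_closed actL_closed actML_closed peiffer_closed
  have d: "\<partial>\<^sub>1 (m \<cdot>\<^sub>M m') = \<partial>\<^sub>1 m \<cdot>\<^sub>P \<partial>\<^sub>1 m'"
    using bd1_hom a by (auto simp: hom_def)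
  have "actML (m \<cdot>\<^sub>M m') l = \<lbrace>m, \<partial>\<^sub>2 (actML m' l)\<rbrace> \<cdot>\<^sub>L
      actL X (\<partial>\<^sub>1 m) \<lbrace>m', \<partial>\<^sub>2 l\<rbrace> \<cdot>\<^sub>L actL X (\<partial>\<^sub>1 m) (actL X (\<partial>\<^sub>1 m') l)"
    using cl by (simp add: actML_eq[of "m \<cdot>\<^sub>M m'"] PL3_left bd2_actML d actL_compose)
  also have "\<dots> = \<lbrace>m, \<partial>\<^sub>2 (actML m' l)\<rbrace> \<cdot>\<^sub>L actL X (\<partial>\<^sub>1 m) (actML m' l)"
    using cl by (simp add: L.m_assoc actL_hom actML_eq[of m' l])
  also have "\<dots> = actML m (actML m' l)"
    using cl by (simp add: actML_eq)
  finally show ?thesis .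
qed

lemma actML_action: "(\<lambda>m. \<lambda>l \<in> carrier L. actML m l) \<in> hom M (AutoGroup L)"
proof -
  interpret L: group L by (rule group_L)
  interpret M: group M by (rule group_M)
  have one: "actML \<one>\<^bsub>M\<^esub> l = l" if "l \<in> carrier L" for l
  proof -
    have "\<partial>\<^sub>2 \<one>\<^bsub>L\<^esub> = \<one>\<^bsub>M\<^esub>"
      using bd2_hom by (rule hom_one) unfold_locales
    then show ?thesis using actML_bd2[of "\<one>\<^bsub>L\<^esub>" l] that by simp
  qed
  have bij: "bij_betw (actML m) (carrier L) (carrier L)" if "m \<in> carrier M" for m
    by (rule bij_betw_byWitness[where f' = "actML (inv\<^bsub>M\<^esub> m)"])
      (use that in \<open>auto simp: one actML_closed simp flip: actML_compose\<close>)
  have aut: "(\<lambda>l \<in> carrier L. actML m l) \<in> auto L" if "m \<in> carrier M" for m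
    using that bij[OF that]
    by (auto simp: auto_def Bij_def hom_def actML_closed actML_mult)
  show ?thesis
  proof (rule homI)
    fix m m' assume a: "m \<in> carrier M" "m' \<in> carrier M"
    have "(\<lambda>l \<in> carrier L. actML x l) \<in> Bij (carrier L)" if "x \<in> carrier M" for x
      using aut[OF that] by (simp add: auto_def)
    then show "(\<lambda>l \<in> carrier L. actML (m \<cdot>\<^sub>M m') l) =
        (\<lambda>l \<in> carrier L. actML m l) \<otimes>\<^bsub>AutoGroup L\<^esub> (\<lambda>l \<in> carrier L. actML m' l)"
      using a by (auto simp: AutoGroup_def BijGroup_def compose_def actML_compose actML_closed
          intro!: restrict_ext)
  qed (use aut in \<open>simp add: AutoGroup_def\<close>)
qed

end


section \<open>Morphisms and pullbacks\<close>

definition two_xmod_morphism ::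
  "('l \<Rightarrow> 'l') \<Rightarrow> ('m \<Rightarrow> 'm') \<Rightarrow> ('p \<Rightarrow> 'p') \<Rightarrow>
   ('l, 'm, 'p) two_xmod_data \<Rightarrow> ('l', 'm', 'p') two_xmod_data \<Rightarrow> bool" where
  "two_xmod_morphism f\<^sub>2 f\<^sub>1 f\<^sub>0 X Y \<longleftrightarrow>
     f\<^sub>2 \<in> hom (grpL X) (grpL Y) \<and> f\<^sub>1 \<in> hom (grpM X) (grpM Y) \<and> f\<^sub>0 \<in> hom (grpP X) (grpP Y) \<and>
     (\<forall>m \<in> carrier (grpM X). f\<^sub>0 (bd1 X m) = bd1 Y (f\<^sub>1 m)) \<and>
     (\<forall>l \<in> carrier (grpL X). f\<^sub>1 (bd2 X l) = bd2 Y (f\<^sub>2 l)) \<and>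
     (\<forall>p \<in> carrier (grpP X). \<forall>m \<in> carrier (grpM X). f\<^sub>1 (actM X p m) = actM Y (f\<^sub>0 p) (f\<^sub>1 m)) \<and>
     (\<forall>p \<in> carrier (grpP X). \<forall>l \<in> carrier (grpL X). f\<^sub>2 (actL X p l) = actL Y (f\<^sub>0 p) (f\<^sub>2 l)) \<and>
     (\<forall>m \<in> carrier (grpM X). \<forall>m' \<in> carrier (grpM X).
        peiffer Y (f\<^sub>1 m) (f\<^sub>1 m') = f\<^sub>2 (peiffer X m m'))"

definition pullback_factorization ::
  "('a \<Rightarrow> 'l) \<Rightarrow> ('b \<Rightarrow> 'm) \<Rightarrow> ('a, 'b, 'p) two_xmod_data \<Rightarrow>
   ('l \<Rightarrow> 'h) \<Rightarrow> ('m \<Rightarrow> 'n) \<Rightarrow> ('l, 'm, 'p) two_xmod_data \<Rightarrow>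
   ('a \<Rightarrow> 'h) \<Rightarrow> ('b \<Rightarrow> 'n) \<Rightarrow> bool" where
  "pullback_factorization g\<^sub>2 g\<^sub>1 B \<phi>\<^sub>2 \<phi>\<^sub>1 X f\<^sub>2 f\<^sub>1 \<longleftrightarrow>
     two_xmod_morphism g\<^sub>2 g\<^sub>1 id B X \<and>
     (\<forall>b \<in> carrier (grpL B). \<phi>\<^sub>2 (g\<^sub>2 b) = f\<^sub>2 b) \<and>
     (\<forall>b \<in> carrier (grpM B). \<phi>\<^sub>1 (g\<^sub>1 b) = f\<^sub>1 b)"

text \<open>
  \<open>X\<close> together with \<open>(\<phi>\<^sub>2, \<phi>\<^sub>1, \<phi>)\<close> is a pullback of \<open>Y\<close> along \<open>\<phi>\<close>. HOL cannot quantify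
  over types inside a formula, so the element types \<open>'a\<close>, \<open>'b\<close> of the two upper groups of
  the test objects \<open>B\<close> are type arguments; the full universal property is
  \<open>is_pullback TYPE('a) TYPE('b) \<dots>\<close> for arbitrary \<open>'a\<close> and \<open>'b\<close>.
  Maps matter only on carriers, so uniqueness means agreement on the carriers.
\<close>

definition is_pullback ::
  "'a itself \<Rightarrow> 'b itself \<Rightarrow> ('h, 'n, 'q) two_xmod_data \<Rightarrow> 'p monoid \<Rightarrow> ('p \<Rightarrow> 'q) \<Rightarrow>
   ('l, 'm, 'p) two_xmod_data \<Rightarrow> ('l \<Rightarrow> 'h) \<Rightarrow> ('m \<Rightarrow> 'n) \<Rightarrow> bool" where
  "is_pullback (_ :: 'a itself) (_ :: 'b itself) Y P \<phi> X \<phi>\<^sub>2 \<phi>\<^sub>1 \<longleftrightarrow>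
     two_crossed_module X \<and> grpP X = P \<and> two_xmod_morphism \<phi>\<^sub>2 \<phi>\<^sub>1 \<phi> X Y \<and>
     (\<forall>(B :: ('a, 'b, 'p) two_xmod_data) f\<^sub>2 f\<^sub>1.
        two_crossed_module B \<and> grpP B = P \<and> two_xmod_morphism f\<^sub>2 f\<^sub>1 \<phi> B Y \<longrightarrow>
        (\<exists>g\<^sub>2 g\<^sub>1. pullback_factorization g\<^sub>2 g\<^sub>1 B \<phi>\<^sub>2 \<phi>\<^sub>1 X f\<^sub>2 f\<^sub>1 \<and>
           (\<forall>g\<^sub>2' g\<^sub>1'. pullback_factorization g\<^sub>2' g\<^sub>1' B \<phi>\<^sub>2 \<phi>\<^sub>1 X f\<^sub>2 f\<^sub>1 \<longrightarrow>
              (\<forall>b \<in> carrier (grpL B). g\<^sub>2' b = g\<^sub>2 b) \<and>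
              (\<forall>b \<in> carrier (grpM B). g\<^sub>1' b = g\<^sub>1 b))))"


section \<open>The concrete construction\<close>

definition fibre_set ::
  "('h, 'n, 'q) two_xmod_data \<Rightarrow> 'p monoid \<Rightarrow> ('p \<Rightarrow> 'q) \<Rightarrow> ('n \<times> 'p) set" where
  "fibre_set Y P \<phi> = {(n, p). n \<in> carrier (grpM Y) \<and> p \<in> carrier P \<and> bd1 Y n = \<phi> p}"

definition ker_preimage :: "('h, 'n, 'q) two_xmod_data \<Rightarrow> 'h set" where
  "ker_preimage Y = {h \<in> carrier (grpL Y). bd2 Y h \<in> kernel (grpM Y) (grpP Y) (bd1 Y)}"

definition pullback_two_xmod ::
  "('h, 'n, 'q) two_xmod_data \<Rightarrow> 'p monoid \<Rightarrow> ('p \<Rightarrow> 'q) \<Rightarrow> ('h, 'n \<times> 'p, 'p) two_xmod_data" where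
  "pullback_two_xmod Y P \<phi> =
     \<lparr>grpL = (grpL Y)\<lparr>carrier := ker_preimage Y\<rparr>,
      grpM = (grpM Y \<times>\<times> P)\<lparr>carrier := fibre_set Y P \<phi>\<rparr>,
      grpP = P,
      bd2 = (\<lambda>h. (bd2 Y h, \<one>\<^bsub>P\<^esub>)),
      bd1 = (\<lambda>(n, p). p),
      actL = (\<lambda>p. \<lambda>h \<in> ker_preimage Y. actL Y (\<phi> p) h),
      actM = (\<lambda>p. \<lambda>(n, p') \<in> fibre_set Y P \<phi>.
        (actM Y (\<phi> p) n, p \<otimes>\<^bsub>P\<^esub> p' \<otimes>\<^bsub>P\<^esub> inv\<^bsub>P\<^esub> p)),
      peiffer = (\<lambda>(n, p) (n', p'). peiffer Y n n')\<rparr>"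

end

theory Submission
  imports Defs
begin

text \<open>
  Since \<open>\<partial>\<^sub>1 \<partial>\<^sub>2 = 1\<close>, the group \<open>\<partial>\<^sub>2\<^sup>-\<^sup>1(Ker \<partial>\<^sub>1)\<close> is all of \<open>H\<close>, and the condition
  \<open>\<partial>\<^sub>1 n = \<phi> p\<close> makes every axiom of the pullback the same axiom of \<open>H \<rightarrow> N \<rightarrow> Q\<close>
  in the first component and an identity between conjugates in \<open>P\<close> in the second.
  A morphism \<open>(f\<^sub>2, f\<^sub>1, \<phi>)\<close> out of \<open>B\<close> can factor only through \<open>f\<^sub>2\<close> and
  \<open>b \<mapsto> (f\<^sub>1 b, \<partial>\<^sub>1 b)\<close>, because the second component is forced by compatibility with \<open>\<partial>\<^sub>1\<close>.
\<close>

section \<open>Group cancellation and actions by automorphisms\<close>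

lemma (in group) mult_inv_cancel_left:
  assumes "x \<in> carrier G" "y \<in> carrier G"
  shows "x \<otimes> (inv x \<otimes> y) = y" and "inv x \<otimes> (x \<otimes> y) = y"
  using assms by (simp_all flip: m_assoc)

text \<open>Turns a homomorphism into \<open>AutoGroup G\<close> into the pointwise laws of an
  action, the form in which the axioms of the pullback are checked.\<close>

lemma hom_AutoGroupD:
  assumes "group P" and "group G" and a: "a \<in> hom P (AutoGroup G)"
  shows hom_AutoGroup_closed: "\<lbrakk>p \<in> carrier P; x \<in> carrier G\<rbrakk> \<Longrightarrow> a p x \<in> carrier G"
    and hom_AutoGroup_mult: "\<lbrakk>p \<in> carrier P; x \<in> carrier G; y \<in> carrier G\<rbrakk>
      \<Longrightarrow> a p (x \<otimes>\<^bsub>G\<^esub> y) = a p x \<otimes>\<^bsub>G\<^esub> a p y"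
    and hom_AutoGroup_one: "x \<in> carrier G \<Longrightarrow> a \<one>\<^bsub>P\<^esub> x = x"
    and hom_AutoGroup_compose: "\<lbrakk>p \<in> carrier P; q \<in> carrier P; x \<in> carrier G\<rbrakk>
      \<Longrightarrow> a (p \<otimes>\<^bsub>P\<^esub> q) x = a p (a q x)"
    and hom_AutoGroup_extensional: "p \<in> carrier P \<Longrightarrow> a p \<in> extensional (carrier G)"
proof -
  have auto: "a p \<in> auto G" if "p \<in> carrier P" for p
    using a that by (auto simp: hom_def AutoGroup_def)
  then have Bij: "a p \<in> Bij (carrier G)" if "p \<in> carrier P" for p
    using that by (auto simp: auto_def)
  show "\<lbrakk>p \<in> carrier P; x \<in> carrier G\<rbrakk> \<Longrightarrow> a p x \<in> carrier G" for p x
    using auto by (auto simp: auto_def hom_def)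
  show "\<lbrakk>p \<in> carrier P; x \<in> carrier G; y \<in> carrier G\<rbrakk>
      \<Longrightarrow> a p (x \<otimes>\<^bsub>G\<^esub> y) = a p x \<otimes>\<^bsub>G\<^esub> a p y" for p x y
    using auto by (auto simp: auto_def hom_def)
  \<comment> \<open>The unit of \<open>AutoGroup G\<close> is the identity restricted to
    \<open>carrier G\<close>, so evaluating it recovers \<open>x\<close> there.\<close>
  have "a \<one>\<^bsub>P\<^esub> = \<one>\<^bsub>AutoGroup G\<^esub>"
    using hom_one[OF a \<open>group P\<close> group.AutoGroup[OF \<open>group G\<close>]] .
  then show "x \<in> carrier G \<Longrightarrow> a \<one>\<^bsub>P\<^esub> x = x" for x
    by (simp add: AutoGroup_def BijGroup_def)
  show "a (p \<otimes>\<^bsub>P\<^esub> q) x = a p (a q x)"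
    if "p \<in> carrier P" "q \<in> carrier P" "x \<in> carrier G" for p q x
  proof -
    have "a (p \<otimes>\<^bsub>P\<^esub> q) = a p \<otimes>\<^bsub>AutoGroup G\<^esub> a q"
      using a that by (auto simp: hom_def)
    then show ?thesis
      using that Bij by (simp add: AutoGroup_def BijGroup_def compose_def)
  qed
  show "p \<in> carrier P \<Longrightarrow> a p \<in> extensional (carrier G)" for p
    using Bij by (auto simp: Bij_def)
qed

text \<open>A converse of the preceding rules. Bijectivity of \<open>a p\<close> comes from the
  action laws, since \<open>a (inv p)\<close> is a two-sided inverse; restricting supplies the
  extensionality that \<open>AutoGroup G\<close> demands.\<close>

lemma restrict_hom_AutoGroup:
  assumes "group P"
    and closed: "\<And>p x. \<lbrakk>p \<in> carrier P; x \<in> carrier G\<rbrakk> \<Longrightarrow> a p x \<in> carrier G"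
    and mult: "\<And>p x y. \<lbrakk>p \<in> carrier P; x \<in> carrier G; y \<in> carrier G\<rbrakk>
      \<Longrightarrow> a p (x \<otimes>\<^bsub>G\<^esub> y) = a p x \<otimes>\<^bsub>G\<^esub> a p y"
    and one: "\<And>x. x \<in> carrier G \<Longrightarrow> a \<one>\<^bsub>P\<^esub> x = x"
    and compose: "\<And>p q x. \<lbrakk>p \<in> carrier P; q \<in> carrier P; x \<in> carrier G\<rbrakk>
      \<Longrightarrow> a (p \<otimes>\<^bsub>P\<^esub> q) x = a p (a q x)"
    and m_closed: "\<And>x y. \<lbrakk>x \<in> carrier G; y \<in> carrier G\<rbrakk> \<Longrightarrow> x \<otimes>\<^bsub>G\<^esub> y \<in> carrier G"
  shows "(\<lambda>p. \<lambda>x \<in> carrier G. a p x) \<in> hom P (AutoGroup G)"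
proof -
  interpret P: group P by fact
  have "bij_betw (a p) (carrier G) (carrier G)" if "p \<in> carrier P" for p
    by (rule bij_betw_byWitness[where f' = "a (inv\<^bsub>P\<^esub> p)"])
      (use that in \<open>auto simp: one closed simp flip: compose\<close>)
  then have aut: "(\<lambda>x \<in> carrier G. a p x) \<in> auto G" if "p \<in> carrier P" for p
    using that by (auto simp: auto_def Bij_def hom_def closed mult m_closed)
  then have Bij: "(\<lambda>x \<in> carrier G. a p x) \<in> Bij (carrier G)" if "p \<in> carrier P" for p
    using that by (auto simp: auto_def)
  show ?thesis
  proof (rule homI)
    fix p q assume "p \<in> carrier P" "q \<in> carrier P"
    then show "(\<lambda>x \<in> carrier G. a (p \<otimes>\<^bsub>P\<^esub> q) x) =
        (\<lambda>x \<in> carrier G. a p x) \<otimes>\<^bsub>AutoGroup G\<^esub> (\<lambda>x \<in> carrier G. a q x)"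
      using Bij by (auto simp: AutoGroup_def BijGroup_def compose_def closed compose
          intro!: restrict_ext)
  qed (use aut in \<open>simp add: AutoGroup_def\<close>)
qed

text \<open>\<open>R\<close> is the group P of the theorem, because the inherited abbreviation
  \<open>P\<close> already denotes \<open>grpP X\<close>, the target of \<phi>. Accordingly
  \<open>L\<close> and \<open>M\<close> stand for H and N.\<close>

locale two_xmod_pullback = two_crossed_module X + R: group R
  for X :: "('h, 'n, 'q) two_xmod_data" and R :: "'p monoid" (structure) +
  fixes \<phi> :: "'p \<Rightarrow> 'q"
  assumes phi_hom: "\<phi> \<in> hom R (grpP X)"
begin

sublocale L: group L by (rule group_L)
sublocale M: group M by (rule group_M)
sublocale P: group P by (rule group_P)
sublocale bd1: group_hom M P "\<partial>\<^sub>1" by unfold_locales (rule bd1_hom)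
sublocale bd2: group_hom L M "\<partial>\<^sub>2" by unfold_locales (rule bd2_hom)
sublocale phi: group_hom R P \<phi> by unfold_locales (rule phi_hom)
sublocale MR: group "M \<times>\<times> R" by (rule DirProd_group) unfold_locales

lemmas actM_closed = hom_AutoGroup_closed[OF group_P group_M actM_action]
lemmas actM_mult = hom_AutoGroup_mult[OF group_P group_M actM_action]
lemmas actM_one = hom_AutoGroup_one[OF group_P group_M actM_action]
lemmas actM_compose = hom_AutoGroup_compose[OF group_P group_M actM_action]

abbreviation F :: "('n \<times> 'p) set" where "F \<equiv> fibre_set X R \<phi>"
abbreviation PB :: "('h, 'n \<times> 'p, 'p) two_xmod_data" where "PB \<equiv> pullback_two_xmod X R \<phi>"

section \<open>The underlying groups of the pullback\<close>

lemma ker_preimage_eq: "ker_preimage X = carrier L"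
  by (auto simp: ker_preimage_def kernel_def bd1_bd2)

lemma mem_fibre_set: "(n, p) \<in> F \<longleftrightarrow> n \<in> carrier M \<and> p \<in> carrier R \<and> \<partial>\<^sub>1 n = \<phi> p"
  by (simp add: fibre_set_def)

text \<open>The set is the equaliser of two homomorphisms
  \<open>M \<times>\<times> R \<rightarrow> P\<close>, namely \<open>\<partial>\<^sub>1\<close> and
  \<phi> after the two projections, hence closed under products and inverses.\<close>

lemma subgroup_fibre_set: "subgroup F (M \<times>\<times> R)"
proof -
  have "(\<one>\<^bsub>M\<^esub>, \<one>\<^bsub>R\<^esub>) \<in> F" by (simp add: fibre_set_def)
  then have "F \<noteq> {}" by blast
  then show ?thesis
    by (intro MR.subgroupI) (auto simp: fibre_set_def inv_DirProd[OF group_M R.is_group])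
qed

lemma group_fibre: "group ((M \<times>\<times> R)\<lparr>carrier := F\<rparr>)"
  by (rule MR.subgroup_imp_group[OF subgroup_fibre_set])

text \<open>Inversion in a subgroup agrees with inversion in the ambient group, which is
  componentwise.\<close>

lemma inv_fibre: "(n, p) \<in> F \<Longrightarrow> inv\<^bsub>(M \<times>\<times> R)\<lparr>carrier := F\<rparr>\<^esub> (n, p) = (inv\<^bsub>M\<^esub> n, inv\<^bsub>R\<^esub> p)"
  by (subst MR.m_inv_consistent[OF subgroup_fibre_set])
    (auto simp: mem_fibre_set inv_DirProd[OF group_M R.is_group])

text \<open>Once \<open>ker_preimage X\<close> is replaced by \<open>carrier L\<close>, updating the
  carrier of \<open>L\<close> changes nothing, so \<open>grpL PB\<close> is \<open>L\<close>
  itself.\<close>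

lemma pullback_two_xmod_simps:
  "grpL PB = L" "grpM PB = (M \<times>\<times> R)\<lparr>carrier := F\<rparr>" "grpP PB = R"
  "bd2 PB = (\<lambda>h. (\<partial>\<^sub>2 h, \<one>\<^bsub>R\<^esub>))" "bd1 PB = (\<lambda>(n, p). p)"
  "actL PB = (\<lambda>p. \<lambda>h \<in> carrier L. actL X (\<phi> p) h)"
  "actM PB = (\<lambda>p. \<lambda>(n, p') \<in> F. (actM X (\<phi> p) n, p \<otimes>\<^bsub>R\<^esub> p' \<otimes>\<^bsub>R\<^esub> inv\<^bsub>R\<^esub> p))"
  "peiffer PB = (\<lambda>(n, p) (n', p'). peiffer X n n')"
  by (auto simp: pullback_two_xmod_def ker_preimage_eq)

section \<open>Actions on the pullback\<close>

lemma actML_pullback: "h \<in> carrier L \<Longrightarrow> two_xmod_data.actML PB (n, p) h = actML n h"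
  by (simp add: two_xmod_data.actML_def pullback_two_xmod_simps)

text \<open>By equivariance of \<open>\<partial>\<^sub>1\<close>, the fibre condition for the new
  pair says that both sides are the conjugate of \<open>\<phi> q\<close> by
  \<open>\<phi> p\<close>.\<close>

lemma actM_fibre: "\<lbrakk>p \<in> carrier R; (n, q) \<in> F\<rbrakk>
    \<Longrightarrow> (actM X (\<phi> p) n, p \<otimes>\<^bsub>R\<^esub> q \<otimes>\<^bsub>R\<^esub> inv\<^bsub>R\<^esub> p) \<in> F"
  by (simp add: mem_fibre_set actM_closed bd1_equivariant)

text \<open>This is the given action composed with \<phi>. The restriction in the definition is
  harmless, as members of \<open>AutoGroup L\<close> are already extensional.\<close>

lemma actL_pullback_action: "actL PB \<in> hom R (AutoGroup L)"
proof -
  have "(\<lambda>p. actL X (\<phi> p)) \<in> hom R (AutoGroup L)"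
    using Group.hom_compose[OF phi_hom actL_action] by (simp add: comp_def)
  moreover have "actL PB p = actL X (\<phi> p)" if "p \<in> carrier R" for p
    using hom_AutoGroup_extensional[OF group_P group_L actL_action] that
    by (simp add: pullback_two_xmod_simps extensional_restrict)
  ultimately show ?thesis by (simp add: hom_def Pi_def)
qed

lemma actM_pullback_action: "actM PB \<in> hom R (AutoGroup (grpM PB))"
proof -
  interpret G: group "(M \<times>\<times> R)\<lparr>carrier := F\<rparr>" by (rule group_fibre)
  let ?a = "\<lambda>p (n, q). (actM X (\<phi> p) n, p \<otimes>\<^bsub>R\<^esub> q \<otimes>\<^bsub>R\<^esub> inv\<^bsub>R\<^esub> p)"
  have "(\<lambda>p. \<lambda>x \<in> carrier ((M \<times>\<times> R)\<lparr>carrier := F\<rparr>). ?a p x)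
      \<in> hom R (AutoGroup ((M \<times>\<times> R)\<lparr>carrier := F\<rparr>))"
  proof (rule restrict_hom_AutoGroup)
    fix p x y
    assume "p \<in> carrier R" "x \<in> carrier ((M \<times>\<times> R)\<lparr>carrier := F\<rparr>)"
      "y \<in> carrier ((M \<times>\<times> R)\<lparr>carrier := F\<rparr>)"
    \<comment> \<open>In the second component the inner \<open>inv p\<close> and \<open>p\<close> of
      two adjacent conjugates cancel.\<close>
    then show "?a p (x \<otimes>\<^bsub>(M \<times>\<times> R)\<lparr>carrier := F\<rparr>\<^esub> y) =
        ?a p x \<otimes>\<^bsub>(M \<times>\<times> R)\<lparr>carrier := F\<rparr>\<^esub> ?a p y"
      by (cases x; cases y) (simp add: mem_fibre_set actM_mult R.m_assoc R.mult_inv_cancel_left)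
  next
    fix p q x
    assume "p \<in> carrier R" "q \<in> carrier R" "x \<in> carrier ((M \<times>\<times> R)\<lparr>carrier := F\<rparr>)"
    then show "?a (p \<otimes>\<^bsub>R\<^esub> q) x = ?a p (?a q x)"
      by (cases x) (simp add: mem_fibre_set actM_compose R.m_assoc R.inv_mult_group)
  qed (use G.m_closed in \<open>auto simp: actM_fibre[simplified] actM_one mem_fibre_set actM_closed
      bd1_equivariant R.is_group\<close>)
  then show ?thesis by (simp add: pullback_two_xmod_simps)
qed

section \<open>Normality of the two images\<close>

lemma bd2_pullback_normal: "bd2 PB ` carrier L \<lhd> grpM PB"
proof -
  have hom: "bd2 PB \<in> hom L (grpM PB)"
    by (auto simp: pullback_two_xmod_simps hom_def mem_fibre_set bd1_bd2)
  interpret h: group_hom L "grpM PB" "bd2 PB"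
    using hom group_fibre group_L
    by (simp add: group_hom_def group_hom_axioms_def pullback_two_xmod_simps)
  show ?thesis
    unfolding h.H.normal_inv_iff
  proof (intro conjI ballI)
    show "subgroup (bd2 PB ` carrier L) (grpM PB)" by (rule h.img_is_subgroup)
    fix x k assume x: "x \<in> carrier (grpM PB)" and k: "k \<in> bd2 PB ` carrier L"
    obtain n p where np: "x = (n, p)" "(n, p) \<in> F"
      using x by (cases x) (simp add: pullback_two_xmod_simps)
    obtain l where l: "l \<in> carrier L" "k = (\<partial>\<^sub>2 l, \<one>\<^bsub>R\<^esub>)"
      using k by (auto simp: pullback_two_xmod_simps)
    have "n \<in> carrier M" "p \<in> carrier R" using np by (auto simp: mem_fibre_set)
    \<comment> \<open>The preimage of the conjugate is the induced action of \<open>n\<close> on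
      \<open>l\<close>: \<open>bd2_actML\<close> settles the first component, and \<open>p\<close>
      conjugates the unit to itself in the second.\<close>
    then have "bd2 PB (actML n l) = x \<otimes>\<^bsub>grpM PB\<^esub> k \<otimes>\<^bsub>grpM PB\<^esub> inv\<^bsub>grpM PB\<^esub> x"
      using np l by (simp add: pullback_two_xmod_simps inv_fibre bd2_actML)
    then show "x \<otimes>\<^bsub>grpM PB\<^esub> k \<otimes>\<^bsub>grpM PB\<^esub> inv\<^bsub>grpM PB\<^esub> x \<in> bd2 PB ` carrier L"
      using actML_closed[OF \<open>n \<in> carrier M\<close> l(1)] by (metis imageI)
  qed
qed

lemma bd1_pullback_hom: "bd1 PB \<in> hom (grpM PB) R"
  by (auto simp: pullback_two_xmod_simps hom_def mem_fibre_set)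

text \<open>Conjugation by \<open>p\<close> is the second component of the action of
  \<open>p\<close> on the fibre product, so it cannot leave the image.\<close>

lemma bd1_pullback_normal: "bd1 PB ` carrier (grpM PB) \<lhd> R"
proof -
  interpret h: group_hom "grpM PB" R "bd1 PB"
    using bd1_pullback_hom group_fibre R.is_group
    by (simp add: group_hom_def group_hom_axioms_def pullback_two_xmod_simps)
  show ?thesis
    unfolding R.normal_inv_iff
  proof (intro conjI ballI)
    show "subgroup (bd1 PB ` carrier (grpM PB)) R" by (rule h.img_is_subgroup)
    fix p q assume p: "p \<in> carrier R" and "q \<in> bd1 PB ` carrier (grpM PB)"
    then obtain n where "(n, q) \<in> F" by (auto simp: pullback_two_xmod_simps)
    from actM_fibre[OF p this]
    show "p \<otimes>\<^bsub>R\<^esub> q \<otimes>\<^bsub>R\<^esub> inv\<^bsub>R\<^esub> p \<in> bd1 PB ` carrier (grpM PB)"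
      by (force simp: pullback_two_xmod_simps)
  qed
qed

section \<open>The axioms of a 2-crossed module\<close>

lemma two_crossed_module_pullback: "two_crossed_module PB"
proof (rule two_crossed_module.intro)
  show "group (grpL PB)" "group (grpM PB)" "group (grpP PB)"
    by (simp_all add: pullback_two_xmod_simps group_fibre group_L R.is_group)
  show "bd2 PB \<in> hom (grpL PB) (grpM PB)"
    by (auto simp: pullback_two_xmod_simps hom_def mem_fibre_set bd1_bd2)
  show "bd1 PB \<in> hom (grpM PB) (grpP PB)"
    using bd1_pullback_hom by (simp add: pullback_two_xmod_simps(3))
  show "bd2 PB ` carrier (grpL PB) \<lhd> grpM PB"
    using bd2_pullback_normal by (simp add: pullback_two_xmod_simps(1))
  show "bd1 PB ` carrier (grpM PB) \<lhd> grpP PB"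
    using bd1_pullback_normal by (simp add: pullback_two_xmod_simps(3))
  show "actL PB \<in> hom (grpP PB) (AutoGroup (grpL PB))"
    using actL_pullback_action by (simp add: pullback_two_xmod_simps(1,3))
  show "actM PB \<in> hom (grpP PB) (AutoGroup (grpM PB))"
    using actM_pullback_action by (simp add: pullback_two_xmod_simps(3))
  fix l assume "l \<in> carrier (grpL PB)"
  then show "bd1 PB (bd2 PB l) = \<one>\<^bsub>grpP PB\<^esub>" by (simp add: pullback_two_xmod_simps)
next
  fix p l assume "p \<in> carrier (grpP PB)" "l \<in> carrier (grpL PB)"
  then show "bd2 PB (actL PB p l) = actM PB p (bd2 PB l)"
    by (simp add: pullback_two_xmod_simps mem_fibre_set bd1_bd2 bd2_equivariant)
next
  fix p m assume "p \<in> carrier (grpP PB)" "m \<in> carrier (grpM PB)"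
  then show "bd1 PB (actM PB p m) = p \<otimes>\<^bsub>grpP PB\<^esub> bd1 PB m \<otimes>\<^bsub>grpP PB\<^esub> inv\<^bsub>grpP PB\<^esub> p"
    by (cases m) (simp add: pullback_two_xmod_simps)
next
  fix m m' assume "m \<in> carrier (grpM PB)" "m' \<in> carrier (grpM PB)"
  then show "peiffer PB m m' \<in> carrier (grpL PB)"
    by (cases m; cases m') (simp add: pullback_two_xmod_simps mem_fibre_set peiffer_closed)
next
  fix m m' assume *: "m \<in> carrier (grpM PB)" "m' \<in> carrier (grpM PB)"
  obtain n p n' p' where [simp]: "m = (n, p)" "m' = (n', p')" by (cases m; cases m')
  have F: "(n, p) \<in> F" "(n', p') \<in> F" using * by (simp_all add: pullback_two_xmod_simps)
  \<comment> \<open>The action in PL1 is a restricted function and unfolds only at arguments known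
    to lie in \<open>F\<close>.\<close>
  then have "(inv\<^bsub>M\<^esub> n', inv\<^bsub>R\<^esub> p') \<in> F" by (simp add: mem_fibre_set)
  with F show "bd2 PB (peiffer PB m m') = m \<otimes>\<^bsub>grpM PB\<^esub> m' \<otimes>\<^bsub>grpM PB\<^esub> inv\<^bsub>grpM PB\<^esub> m
      \<otimes>\<^bsub>grpM PB\<^esub> actM PB (bd1 PB m) (inv\<^bsub>grpM PB\<^esub> m')"
    \<comment> \<open>Membership in \<open>F\<close> stays folded in the first pass, where
      \<open>inv_fibre\<close> and the restricted action need it. The second pass unfolds it,
      turning \<open>\<phi> p\<close> into \<open>\<partial>\<^sub>1 n\<close> for PL1, while the
      second component cancels to the unit.\<close>
    by (simp add: pullback_two_xmod_simps inv_fibre)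
      (simp add: mem_fibre_set PL1 R.m_assoc R.mult_inv_cancel_left)
next
  fix l l' assume "l \<in> carrier (grpL PB)" "l' \<in> carrier (grpL PB)"
  then show "peiffer PB (bd2 PB l) (bd2 PB l') =
      l \<otimes>\<^bsub>grpL PB\<^esub> l' \<otimes>\<^bsub>grpL PB\<^esub> inv\<^bsub>grpL PB\<^esub> l \<otimes>\<^bsub>grpL PB\<^esub> inv\<^bsub>grpL PB\<^esub> l'"
    by (simp add: pullback_two_xmod_simps PL2)
next
  fix m\<^sub>0 m\<^sub>1 m\<^sub>2
  assume *: "m\<^sub>0 \<in> carrier (grpM PB)" "m\<^sub>1 \<in> carrier (grpM PB)" "m\<^sub>2 \<in> carrier (grpM PB)"
  obtain n\<^sub>0 p\<^sub>0 n\<^sub>1 p\<^sub>1 n\<^sub>2 p\<^sub>2 where [simp]: "m\<^sub>0 = (n\<^sub>0, p\<^sub>0)" "m\<^sub>1 = (n\<^sub>1, p\<^sub>1)" "m\<^sub>2 = (n\<^sub>2, p\<^sub>2)"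
    by (cases m\<^sub>0; cases m\<^sub>1; cases m\<^sub>2)
  have F: "(n\<^sub>0, p\<^sub>0) \<in> F" "(n\<^sub>1, p\<^sub>1) \<in> F" "(n\<^sub>2, p\<^sub>2) \<in> F"
    using * by (simp_all add: pullback_two_xmod_simps)
  then have n: "n\<^sub>0 \<in> carrier M" "n\<^sub>1 \<in> carrier M" "n\<^sub>2 \<in> carrier M"
    by (simp_all add: mem_fibre_set)
  \<comment> \<open>Both the lifting and the induced action of a pair see only first components, so
    PL3 carries over.\<close>
  show "peiffer PB m\<^sub>0 (m\<^sub>1 \<otimes>\<^bsub>grpM PB\<^esub> m\<^sub>2) =
      two_xmod_data.actML PB (m\<^sub>0 \<otimes>\<^bsub>grpM PB\<^esub> m\<^sub>1 \<otimes>\<^bsub>grpM PB\<^esub> inv\<^bsub>grpM PB\<^esub> m\<^sub>0) (peiffer PB m\<^sub>0 m\<^sub>2)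
        \<otimes>\<^bsub>grpL PB\<^esub> peiffer PB m\<^sub>0 m\<^sub>1"
    using F n by (simp add: pullback_two_xmod_simps inv_fibre actML_pullback peiffer_closed PL3_right)
  show "peiffer PB (m\<^sub>0 \<otimes>\<^bsub>grpM PB\<^esub> m\<^sub>1) m\<^sub>2 =
      peiffer PB m\<^sub>0 (m\<^sub>1 \<otimes>\<^bsub>grpM PB\<^esub> m\<^sub>2 \<otimes>\<^bsub>grpM PB\<^esub> inv\<^bsub>grpM PB\<^esub> m\<^sub>1)
        \<otimes>\<^bsub>grpL PB\<^esub> actL PB (bd1 PB m\<^sub>0) (peiffer PB m\<^sub>1 m\<^sub>2)"
    \<comment> \<open>The pullback acts through \<open>\<phi> p\<^sub>0\<close> and the original
      axiom through \<open>\<partial>\<^sub>1 n\<^sub>0\<close>; these agree by the fibre condition,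
      which the last simplification brings in.\<close>
    using F n
    by (simp add: pullback_two_xmod_simps inv_fibre peiffer_closed PL3_left) (simp add: mem_fibre_set)
next
  fix l m assume *: "l \<in> carrier (grpL PB)" "m \<in> carrier (grpM PB)"
  obtain n p where [simp]: "m = (n, p)" by (cases m)
  have l: "l \<in> carrier L" and F: "(n, p) \<in> F" using * by (simp_all add: pullback_two_xmod_simps)
  then have n: "n \<in> carrier M" by (simp add: mem_fibre_set)
  show "peiffer PB (bd2 PB l) m = l \<otimes>\<^bsub>grpL PB\<^esub> two_xmod_data.actML PB m (inv\<^bsub>grpL PB\<^esub> l)"
    using l n by (simp add: pullback_two_xmod_simps actML_pullback PL4a)
  show "peiffer PB m (bd2 PB l) =
      two_xmod_data.actML PB m l \<otimes>\<^bsub>grpL PB\<^esub> actL PB (bd1 PB m) (inv\<^bsub>grpL PB\<^esub> l)"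
    \<comment> \<open>Again the fibre condition identifies \<open>\<phi> p\<close> with
      \<open>\<partial>\<^sub>1 n\<close>.\<close>
    using l n F by (simp add: pullback_two_xmod_simps actML_pullback PL4b) (simp add: mem_fibre_set)
next
  fix p m m'
  assume *: "p \<in> carrier (grpP PB)" "m \<in> carrier (grpM PB)" "m' \<in> carrier (grpM PB)"
  then show "actL PB p (peiffer PB m m') = peiffer PB (actM PB p m) (actM PB p m')"
    by (cases m; cases m')
      (simp add: pullback_two_xmod_simps, simp add: mem_fibre_set peiffer_closed PL5)
qed

section \<open>The structure morphism and the universal property\<close>

lemma morphism_pullback: "two_xmod_morphism (\<lambda>h. h) (\<lambda>(n, p). n) \<phi> PB X"
  using phi_hom unfolding two_xmod_morphism_def
  by (auto simp: pullback_two_xmod_simps hom_def mem_fibre_set)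

lemma pullback_factorization_exists:
  assumes "two_crossed_module B" and "grpP B = R" and f: "two_xmod_morphism f\<^sub>2 f\<^sub>1 \<phi> B X"
  shows "pullback_factorization f\<^sub>2 (\<lambda>b. (f\<^sub>1 b, bd1 B b)) B (\<lambda>h. h) (\<lambda>(n, p). n) PB f\<^sub>2 f\<^sub>1"
proof -
  interpret B: two_crossed_module B by fact
  have f1: "f\<^sub>1 \<in> hom B.M M" and f2: "f\<^sub>2 \<in> hom B.L L"
    using f by (auto simp: two_xmod_morphism_def)
  \<comment> \<open>The fibre condition is the compatibility of the given morphism with the
    boundaries \<open>bd1\<close>.\<close>
  have F: "(f\<^sub>1 b, bd1 B b) \<in> F" if "b \<in> carrier B.M" for b
    using f that f1 B.bd1_closed[OF that] \<open>grpP B = R\<close>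
    by (auto simp: mem_fibre_set two_xmod_morphism_def hom_def)
  show ?thesis
    unfolding pullback_factorization_def two_xmod_morphism_def
  proof (intro conjI ballI)
    show "f\<^sub>2 \<in> hom B.L (grpL PB)" using f2 by (simp add: pullback_two_xmod_simps)
    show "(\<lambda>b. (f\<^sub>1 b, bd1 B b)) \<in> hom B.M (grpM PB)"
      using f1 B.bd1_hom F \<open>grpP B = R\<close> by (auto simp: pullback_two_xmod_simps hom_def)
    show "id \<in> hom B.P (grpP PB)"
      using \<open>grpP B = R\<close> by (auto simp: pullback_two_xmod_simps hom_def)
  next
    fix b assume "b \<in> carrier B.L"
    then show "(f\<^sub>1 (bd2 B b), bd1 B (bd2 B b)) = bd2 PB (f\<^sub>2 b)"
      using f B.bd1_bd2 \<open>grpP B = R\<close> by (simp add: two_xmod_morphism_def pullback_two_xmod_simps)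
  next
    \<comment> \<open>Equivariance of \<open>f\<^sub>1\<close> gives the first component, and that
      of \<open>bd1 B\<close> the conjugate by \<open>p\<close> in the second.\<close>
    fix p b assume "p \<in> carrier B.P" "b \<in> carrier B.M"
    then show "(f\<^sub>1 (actM B p b), bd1 B (actM B p b)) = actM PB (id p) (f\<^sub>1 b, bd1 B b)"
      using f F B.bd1_equivariant \<open>grpP B = R\<close>
      by (simp add: two_xmod_morphism_def pullback_two_xmod_simps)
  next
    fix p b assume "p \<in> carrier B.P" "b \<in> carrier B.L"
    then show "f\<^sub>2 (actL B p b) = actL PB (id p) (f\<^sub>2 b)"
      using f f2 by (auto simp: two_xmod_morphism_def pullback_two_xmod_simps hom_def)
  qed (use f in \<open>auto simp: two_xmod_morphism_def pullback_two_xmod_simps\<close>)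
qed

text \<open>The two triangles fix \<open>g\<^sub>2\<close> and the first component of
  \<open>g\<^sub>1\<close>. Its second component is the boundary \<open>bd1 PB\<close> of
  \<open>g\<^sub>1 b'\<close>, which equals \<open>bd1 B b'\<close> as the morphism is the identity
  on \<open>R\<close>.\<close>

lemma pullback_factorization_unique:
  assumes g: "pullback_factorization g\<^sub>2 g\<^sub>1 B (\<lambda>h. h) (\<lambda>(n, p). n) PB f\<^sub>2 f\<^sub>1"
  shows "b \<in> carrier (grpL B) \<Longrightarrow> g\<^sub>2 b = f\<^sub>2 b"
    and "b' \<in> carrier (grpM B) \<Longrightarrow> g\<^sub>1 b' = (f\<^sub>1 b', bd1 B b')"
  using g by (auto simp: pullback_factorization_def two_xmod_morphism_def pullback_two_xmod_simps
      prod_eq_iff case_prod_beta)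

lemma is_pullback_pullback_two_xmod:
  "is_pullback TYPE('a) TYPE('b) X R \<phi> PB (\<lambda>h. h) (\<lambda>(n, p). n)"
  unfolding is_pullback_def
proof (intro conjI allI impI)
  show "grpP PB = R" by (rule pullback_two_xmod_simps)
  fix B :: "('a, 'b, 'p) two_xmod_data" and f\<^sub>2 f\<^sub>1
  assume B: "two_crossed_module B \<and> grpP B = R \<and> two_xmod_morphism f\<^sub>2 f\<^sub>1 \<phi> B X"
  show "\<exists>g\<^sub>2 g\<^sub>1. pullback_factorization g\<^sub>2 g\<^sub>1 B (\<lambda>h. h) (\<lambda>(n, p). n) PB f\<^sub>2 f\<^sub>1 \<and>
      (\<forall>g\<^sub>2' g\<^sub>1'. pullback_factorization g\<^sub>2' g\<^sub>1' B (\<lambda>h. h) (\<lambda>(n, p). n) PB f\<^sub>2 f\<^sub>1 \<longrightarrow>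
        (\<forall>b \<in> carrier (grpL B). g\<^sub>2' b = g\<^sub>2 b) \<and> (\<forall>b \<in> carrier (grpM B). g\<^sub>1' b = g\<^sub>1 b))"
    by (intro exI[of _ f\<^sub>2] exI[of _ "\<lambda>b. (f\<^sub>1 b, bd1 B b)"])
      (use B in \<open>simp add: pullback_factorization_exists pullback_factorization_unique\<close>)
qed (rule two_crossed_module_pullback morphism_pullback)+

end

theorem theorem8:
  fixes Y :: "('h, 'n, 'q) two_xmod_data" and P :: "'p monoid" and \<phi> :: "'p \<Rightarrow> 'q"
  assumes "two_crossed_module Y" and "group P" and "\<phi> \<in> hom P (grpP Y)"
  shows "subgroup (fibre_set Y P \<phi>) (grpM Y \<times>\<times> P) \<and>
    is_pullback TYPE('a) TYPE('b) Y P \<phi> (pullback_two_xmod Y P \<phi>) (\<lambda>h. h) (\<lambda>(n, p). n)"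
proof -
  interpret two_xmod_pullback Y P \<phi>
    using assms by (simp add: two_xmod_pullback_def two_xmod_pullback_axioms_def)
  show ?thesis
    using subgroup_fibre_set is_pullback_pullback_two_xmod by blast
qed

end
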